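(* Let $P$ be a non-degenerate probability distribution on $[0,1]$ with mean $m$, and let $X_1,X_2,\dots$ be i.i.d. with law $P$. Let $\boldsymbol\lambda=(\lambda_n)_{n\ge 1}$ be a predictable process taking values in $[-\frac{1}{1-m},\frac1m]$. Then the wealth process $$W_n^{\boldsymbol\lambda}=\prod_{k=1}^n\bigl(1+\lambda_k(X_k-m)\bigr)$$ converges almost surely to a random variable $W_\infty$ satisfying $$\{W_\infty=0\}=\Bigl\{\sum_{n=1}^\infty\lambda_n^2=\infty\Bigr\}\cup\bigcup_{n=1}^\infty\{\lambda_n(X_n-m)=-1\},$$ and consequently $$\{W_\infty>0\}=\Bigl\{\sum_{n=1}^\infty\lambda_n^2<\infty\Bigr\}\cap\bigcap_{n=1}^\infty\{\lambda_n(X_n-m)>-1\}.$$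
   Context: The random variables $X_n$ take values in $[0,1]$. "Non-degenerate" means that $P$ is not a point mass (so $0<m<1$). "Predictable" means that $\lambda_n$ is $\sigma(X_1,\dots,X_{n-1})$-measurable for each $n\ge1$ (so $\lambda_1$ is deterministic). The almost sure limit $W_\infty$ is determined only up to a null set; the equalities of events are understood up to $P$-null sets, equivalently they hold for a suitable version of $W_\infty$. *)

theory Defs
  imports "HOL-Probability.Probability"
begin

definition point_mass :: "real measure \<Rightarrow> bool" where
  "point_mass P \<longleftrightarrow> (\<exists>c. P = return borel c)"

text \<open>The sigma-algebra generated by \<open>X 1, \<dots>, X (n - 1)\<close>. For \<open>n = 1\<close> there are no
  generators and it is the trivial sigma-algebra on \<open>space M\<close>.\<close>

definition past :: "'a measure \<Rightarrow> (nat \<Rightarrow> 'a \<Rightarrow> real) \<Rightarrow> nat \<Rightarrow> 'a measure" where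
  "past M X n = sigma (space M) (\<Union>i\<in>{1..<n}. {X i -` A \<inter> space M | A. A \<in> sets borel})"

text \<open>Time starts at 1; the values of processes at index 0 are never used.\<close>

definition predictable :: "'a measure \<Rightarrow> (nat \<Rightarrow> 'a \<Rightarrow> real) \<Rightarrow> (nat \<Rightarrow> 'a \<Rightarrow> real) \<Rightarrow> bool" where
  "predictable M X lam \<longleftrightarrow> (\<forall>n\<ge>1. lam n \<in> borel_measurable (past M X n))"

definition wealth ::
  "real \<Rightarrow> (nat \<Rightarrow> 'a \<Rightarrow> real) \<Rightarrow> (nat \<Rightarrow> 'a \<Rightarrow> real) \<Rightarrow> nat \<Rightarrow> 'a \<Rightarrow> real" where
  "wealth m lam X n \<omega> = (\<Prod>k=1..n. 1 + lam k \<omega> * (X k \<omega> - m))"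

text \<open>Equality of events up to null sets.\<close>

definition ae_eq :: "'a measure \<Rightarrow> 'a set \<Rightarrow> 'a set \<Rightarrow> bool" where
  "ae_eq M A B \<longleftrightarrow> A \<in> sets M \<and> B \<in> sets M \<and> (AE \<omega> in M. \<omega> \<in> A \<longleftrightarrow> \<omega> \<in> B)"

text \<open>The almost sure limit is determined only up to a null set: \<open>is_as_limit M Y W\<close> says that
  \<open>W\<close> is one of its versions.\<close>

definition is_as_limit ::
  "'a measure \<Rightarrow> (nat \<Rightarrow> 'a \<Rightarrow> real) \<Rightarrow> ('a \<Rightarrow> real) \<Rightarrow> bool" where
  "is_as_limit M Y W \<longleftrightarrow> W \<in> borel_measurable M \<and> (AE \<omega> in M. (\<lambda>n. Y n \<omega>) \<longlonglongrightarrow> W \<omega>)"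

end

theory Submission
  imports Defs
begin

text \<open>Write \<open>Y k = lam k * (X k - m)\<close>, so that \<open>Y k \<ge> -1\<close> and \<open>\<bar>Y k\<bar> \<le> \<bar>lam k\<bar>\<close>.

Where \<open>\<Sum>lam\<^sup>2 < \<infinity>\<close>, the squares \<open>Y\<^sup>2\<close> are summable trivially, and \<open>\<Sum>Y\<close> converges almost surely by
Kolmogorov's inequality applied to \<open>lam\<close> set to zero once \<open>\<Sum>lam\<^sup>2\<close> has exceeded a level \<open>N\<close>. As
\<open>ln (1 + Y) = Y + O(Y\<^sup>2)\<close>, the product then converges to a positive limit unless a factor vanishes.

In general \<open>sqrt (1 + y) \<le> 1 + y / 2 - c * y\<^sup>2\<close> for \<open>y\<close> bounded above, so
\<open>sqrt (W n) * exp (d * (\<Sum>k\<le>n. (lam k)\<^sup>2))\<close> is a nonnegative supermartingale for \<open>d = c * Var X\<close>. It is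
almost surely bounded by Ville's inequality, which forces \<open>W n \<rightarrow> 0\<close> where \<open>\<Sum>lam\<^sup>2 = \<infinity>\<close>.\<close>

section \<open>Sequences and elementary inequalities\<close>

text \<open>Once |y k| < 1/2, \<open>ln (1 + y k)\<close> differs from \<open>y k\<close> by at most
  twice its square, so the series of logarithms converges even when \<open>y\<close> is only
  conditionally summable. The limit of the product is the exponential of a real number, hence
  positive.\<close>

lemma prod_one_plus_tendsto_pos:
  fixes y :: "nat \<Rightarrow> real"
  assumes pos: "\<And>k. 0 < 1 + y k" and sq: "summable (\<lambda>k. (y k)\<^sup>2)" and sm: "summable y"
  shows "\<exists>L>0. (\<lambda>n. \<Prod>k<n. 1 + y k) \<longlonglongrightarrow> L"
proof -
  have "y \<longlonglongrightarrow> 0" using sm by (rule summable_LIMSEQ_zero)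
  then have "\<forall>\<^sub>F k in sequentially. \<bar>y k\<bar> < 1/2"
    by (auto simp: tendsto_iff dist_real_def dest: spec[of _ "1/2"])
  then have "\<forall>\<^sub>F k in sequentially. norm (ln (1 + y k) - y k) \<le> 2 * (y k)\<^sup>2"
    by (rule eventually_mono) (use abs_ln_one_plus_x_minus_x_bound in auto)
  then have "summable (\<lambda>k. ln (1 + y k) - y k)"
    by (rule summable_comparison_test_ev) (intro summable_mult sq)
  then have "summable (\<lambda>k. (ln (1 + y k) - y k) + y k)" using sm by (rule summable_add)
  then have "summable (\<lambda>k. ln (1 + y k))" by simp
  then have "(\<lambda>n. \<Sum>k<n. ln (1 + y k)) \<longlonglongrightarrow> (\<Sum>k. ln (1 + y k))" by (rule summable_LIMSEQ)
  then have "(\<lambda>n. exp (\<Sum>k<n. ln (1 + y k))) \<longlonglongrightarrow> exp (\<Sum>k. ln (1 + y k))" by (rule tendsto_exp)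
  moreover have "exp (\<Sum>k<n. ln (1 + y k)) = (\<Prod>k<n. 1 + y k)" for n
    using pos by (simp add: exp_sum)
  ultimately show ?thesis by (auto intro!: exI[of _ "exp (\<Sum>k. ln (1 + y k))"])
qed

lemma not_summable_partial_sums_unbounded:
  fixes f :: "nat \<Rightarrow> real"
  assumes "\<And>k. 0 \<le> f k" "\<not> summable f"
  shows "filterlim (\<lambda>n. \<Sum>k<n. f k) at_top sequentially"
  unfolding filterlim_at_top
proof
  fix B
  obtain N where N: "B < (\<Sum>k<N. f k)"
    using summableI_nonneg_bounded[of f B] assms by (meson not_le)
  show "\<forall>\<^sub>F n in sequentially. B \<le> (\<Sum>k<n. f k)"
    unfolding eventually_sequentially
  proof (intro exI allI impI)
    fix n assume "N \<le> n"
    then have "(\<Sum>k<N. f k) \<le> (\<Sum>k<n. f k)" using assms(1) by (intro sum_mono2) auto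
    then show "B \<le> (\<Sum>k<n. f k)" using N by simp
  qed
qed

text \<open>With \<open>r = sqrt (1 + y)\<close> one has \<open>1 + y / 2 - r = (r - 1)\<^sup>2 / 2\<close> and \<open>y = (r - 1) * (r + 1)\<close>.\<close>

lemma sqrt_one_plus_le:
  fixes y C :: real
  assumes "-1 \<le> y" "y \<le> C"
  shows "sqrt (1 + y) \<le> 1 + y / 2 - 1 / (2 * (sqrt (1 + C) + 1)\<^sup>2) * y\<^sup>2"
proof -
  define r where "r = sqrt (1 + y)"
  define R where "R = sqrt (1 + C)"
  have r: "0 \<le> r" "r \<le> R" and y: "y = r\<^sup>2 - 1" using assms by (auto simp: r_def R_def)
  have "y\<^sup>2 = (r - 1)\<^sup>2 * (r + 1)\<^sup>2" unfolding y by (simp add: power2_eq_square algebra_simps)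
  also have "\<dots> \<le> (r - 1)\<^sup>2 * (R + 1)\<^sup>2" using r by (intro mult_left_mono power_mono) auto
  finally have "y\<^sup>2 / (2 * (R + 1)\<^sup>2) \<le> (r - 1)\<^sup>2 / 2"
    using r by (simp add: field_simps)
  also have "\<dots> = 1 + y / 2 - r" unfolding y by (simp add: power2_eq_square field_simps)
  finally show ?thesis by (simp add: r_def R_def)
qed

section \<open>Bounded measurable functions\<close>

text \<open>\<open>N\<close> acts purely as a sigma-algebra: the bound holds at every point of the
  space, not almost everywhere, so it makes sense for \<open>past M X n\<close>, which
  \<open>sigma\<close> equips with the zero measure. Integrals are always taken with respect to
  \<open>M\<close>.\<close>

definition bounded_measurable :: "'a measure \<Rightarrow> ('a \<Rightarrow> real) \<Rightarrow> bool" where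
  "bounded_measurable N f \<longleftrightarrow> f \<in> borel_measurable N \<and> (\<exists>B. \<forall>\<omega>\<in>space N. \<bar>f \<omega>\<bar> \<le> B)"

lemma bounded_measurableI:
  assumes "f \<in> borel_measurable N" "\<And>\<omega>. \<omega> \<in> space N \<Longrightarrow> \<bar>f \<omega>\<bar> \<le> B"
  shows "bounded_measurable N f"
  using assms unfolding bounded_measurable_def by blast

lemma bounded_measurable_const: "bounded_measurable N (\<lambda>_. c)"
  by (rule bounded_measurableI) auto

lemma bounded_measurable_indicator: "A \<in> sets N \<Longrightarrow> bounded_measurable N (indicator A)"
  by (rule bounded_measurableI[where B=1]) (auto simp: indicator_def)

lemma bounded_measurable_add:
  assumes "bounded_measurable N f" "bounded_measurable N g"
  shows "bounded_measurable N (\<lambda>\<omega>. f \<omega> + g \<omega>)"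
proof -
  obtain B C where "f \<in> borel_measurable N" "\<forall>\<omega>\<in>space N. \<bar>f \<omega>\<bar> \<le> B"
    "g \<in> borel_measurable N" "\<forall>\<omega>\<in>space N. \<bar>g \<omega>\<bar> \<le> C"
    using assms unfolding bounded_measurable_def by blast
  then show ?thesis
    by (intro bounded_measurableI[where B="B + C"]) (auto intro: order_trans[OF abs_triangle_ineq] add_mono)
qed

lemma bounded_measurable_mult:
  assumes "bounded_measurable N f" "bounded_measurable N g"
  shows "bounded_measurable N (\<lambda>\<omega>. f \<omega> * g \<omega>)"
proof -
  obtain B C where "f \<in> borel_measurable N" "\<forall>\<omega>\<in>space N. \<bar>f \<omega>\<bar> \<le> B"
    "g \<in> borel_measurable N" "\<forall>\<omega>\<in>space N. \<bar>g \<omega>\<bar> \<le> C"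
    using assms unfolding bounded_measurable_def by blast
  then show ?thesis
    by (intro bounded_measurableI[where B="\<bar>B\<bar> * \<bar>C\<bar>"])
      (auto simp: abs_mult intro!: mult_mono intro: order_trans)
qed

lemma bounded_measurable_diff:
  assumes "bounded_measurable N f" "bounded_measurable N g"
  shows "bounded_measurable N (\<lambda>\<omega>. f \<omega> - g \<omega>)"
  using bounded_measurable_add[OF assms(1) bounded_measurable_mult[OF bounded_measurable_const[of N "-1"] assms(2)]]
  by simp

lemma bounded_measurable_power:
  assumes "bounded_measurable N f"
  shows "bounded_measurable N (\<lambda>\<omega>. f \<omega> ^ k)"
  by (induction k) (auto intro: bounded_measurable_const bounded_measurable_mult assms)

lemma bounded_measurable_sum:
  assumes "\<And>k. k \<in> I \<Longrightarrow> bounded_measurable N (f k)"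
  shows "bounded_measurable N (\<lambda>\<omega>. \<Sum>k\<in>I. f k \<omega>)"
  using assms
  by (induction I rule: infinite_finite_induct) (auto intro: bounded_measurable_const bounded_measurable_add)

lemma bounded_measurable_prod:
  assumes "\<And>k. k \<in> I \<Longrightarrow> bounded_measurable N (f k)"
  shows "bounded_measurable N (\<lambda>\<omega>. \<Prod>k\<in>I. f k \<omega>)"
  using assms
  by (induction I rule: infinite_finite_induct) (auto intro: bounded_measurable_const bounded_measurable_mult)

text \<open>The values of \<open>f\<close> lie in a compact interval, on which \<open>h\<close> is
  bounded. This covers the square roots and the exponentials in the supermartingale, unbounded
  functions of bounded arguments.\<close>

lemma bounded_measurable_continuous:
  assumes "bounded_measurable N f" "continuous_on UNIV (h :: real \<Rightarrow> real)"
  shows "bounded_measurable N (\<lambda>\<omega>. h (f \<omega>))"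
proof -
  obtain B where f: "f \<in> borel_measurable N" "\<forall>\<omega>\<in>space N. \<bar>f \<omega>\<bar> \<le> B"
    using assms unfolding bounded_measurable_def by blast
  have "compact (h ` {-B..B})"
    using assms(2) by (intro compact_continuous_image) (auto intro: continuous_on_subset)
  then obtain C where "\<forall>y\<in>h ` {-B..B}. norm y \<le> C"
    using compact_imp_bounded bounded_iff by blast
  with f assms(2) show ?thesis
    by (intro bounded_measurableI[where B=C])
      (auto intro!: borel_measurable_continuous_on[of h] simp: abs_le_iff)
qed

lemma bounded_measurable_subalgebra:
  assumes "subalgebra M N" "bounded_measurable N f"
  shows "bounded_measurable M f"
  using assms(2) measurable_from_subalg[OF assms(1), of f borel] assms(1)
  unfolding bounded_measurable_def subalgebra_def by metis

lemma (in prob_space) bounded_measurable_integrable: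
  assumes "bounded_measurable M f"
  shows "integrable M f"
proof -
  obtain B where "f \<in> borel_measurable M" "\<forall>\<omega>\<in>space M. \<bar>f \<omega>\<bar> \<le> B"
    using assms unfolding bounded_measurable_def by blast
  then show ?thesis by (intro integrable_const_bound[where B=B]) auto
qed

section \<open>A maximal inequality\<close>

text \<open>\<open>b = 0\<close> is Ville's inequality for supermartingales; \<open>Z = S\<^sup>2\<close> with \<open>b\<close> the variance of the
increments is Kolmogorov's inequality.\<close>

lemma (in prob_space) maximal_inequality_finite:
  fixes F :: "nat \<Rightarrow> 'a measure" and Z :: "nat \<Rightarrow> 'a \<Rightarrow> real"
  assumes sub: "\<And>n. subalgebra M (F n)" and mono: "\<And>n. sets (F n) \<subseteq> sets (F (Suc n))"
    and Z: "\<And>n. Z n \<in> borel_measurable (F n)" and int: "\<And>n. integrable M (Z n)"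
    and nonneg: "\<And>n \<omega>. \<omega> \<in> space M \<Longrightarrow> 0 \<le> Z n \<omega>"
    and step: "\<And>n A. A \<in> sets (F n) \<Longrightarrow>
      expectation (\<lambda>\<omega>. Z (Suc n) \<omega> * indicator A \<omega>) \<le> expectation (\<lambda>\<omega>. Z n \<omega> * indicator A \<omega>) + b n"
    and a: "0 \<le> a"
  shows "a * prob {\<omega> \<in> space M. \<exists>k\<le>n. a \<le> Z k \<omega>} \<le> expectation (Z 0) + (\<Sum>k<n. b k)"
proof -
  have monoF: "sets (F k) \<subseteq> sets (F n)" if "k \<le> n" for k n
    using that mono by (rule lift_Suc_mono_le[rotated])
  have spF: "space (F n) = space M" for n using sub[of n] by (auto simp: subalgebra_def)
  \<comment> \<open>The event that level \<open>a\<close> has not been reached up to time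
    \<open>n\<close>. It is known at time \<open>n\<close>, so \<open>step\<close> may be applied to
    it.\<close>
  define A where "A n = {\<omega> \<in> space M. \<forall>k\<le>n. Z k \<omega> < a}" for n
  have AF: "A n \<in> sets (F n)" for n
  proof -
    have "{\<omega> \<in> space (F n). Z k \<omega> < a} \<in> sets (F n)" if "k \<le> n" for k
    proof -
      have "{\<omega> \<in> space (F k). Z k \<omega> < a} \<in> sets (F k)" using Z[of k] by measurable
      then show ?thesis using monoF[OF that] spF by auto
    qed
    then have "(\<Inter>k\<in>{..n}. {\<omega> \<in> space (F n). Z k \<omega> < a}) \<in> sets (F n)"
      by (intro sets.finite_INT) auto
    moreover have "A n = (\<Inter>k\<in>{..n}. {\<omega> \<in> space (F n). Z k \<omega> < a})"
      by (auto simp: A_def spF)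
    ultimately show ?thesis by simp
  qed
  have AM[measurable]: "A n \<in> events" for n using AF[of n] sub[of n] by (auto simp: subalgebra_def)
  \<comment> \<open>\<open>Z\<close> stopped on reaching the level, with the value at the stopping
    time, which is at least \<open>a\<close>, replaced by \<open>a\<close>.\<close>
  define U where "U n \<omega> = a * indicator (space M - A n) \<omega> + Z n \<omega> * indicator (A n) \<omega>" for n \<omega>
  have iZ: "integrable M (\<lambda>\<omega>. Z n \<omega> * indicator (A k) \<omega>)" for n k
    using integrable_mult_indicator[OF AM[of k] int[of n]] by (simp add: mult.commute)
  have iU: "integrable M (U n)" for n
    unfolding U_def using iZ by (auto simp: less_top[symmetric])
  have U: "expectation (U n) \<le> expectation (Z 0) + (\<Sum>k<n. b k)" for n
  proof (induction n)
    case 0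
    have "expectation (U 0) \<le> expectation (Z 0)"
      using nonneg by (intro integral_mono iU int) (auto simp: U_def A_def indicator_def)
    then show ?case by simp
  next
    case (Suc n)
    \<comment> \<open>On the part of \<open>A n\<close> that leaves \<open>A (Suc n)\<close>, the
      level is reached exactly at time \<open>Suc n\<close>, so there \<open>a\<close> is at most
      \<open>Z (Suc n)\<close>.\<close>
    have "expectation (U (Suc n)) \<le> expectation (\<lambda>\<omega>. a * indicator (space M - A n) \<omega> + Z (Suc n) \<omega> * indicator (A n) \<omega>)"
    proof (rule integral_mono[OF iU])
      show "integrable M (\<lambda>\<omega>. a * indicator (space M - A n) \<omega> + Z (Suc n) \<omega> * indicator (A n) \<omega>)"
        using iZ by (auto simp: less_top[symmetric])
    qed (use nonneg in \<open>auto simp: U_def A_def indicator_def le_Suc_eq\<close>)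
    also have "\<dots> = expectation (\<lambda>\<omega>. a * indicator (space M - A n) \<omega>) + expectation (\<lambda>\<omega>. Z (Suc n) \<omega> * indicator (A n) \<omega>)"
      using iZ by (intro Bochner_Integration.integral_add) (auto simp: less_top[symmetric])
    also have "\<dots> \<le> expectation (\<lambda>\<omega>. a * indicator (space M - A n) \<omega>) + expectation (\<lambda>\<omega>. Z n \<omega> * indicator (A n) \<omega>) + b n"
      using step[OF AF[of n]] by simp
    also have "\<dots> = expectation (U n) + b n"
      unfolding U_def using iZ by (subst Bochner_Integration.integral_add) (auto simp: less_top[symmetric])
    finally show ?case using Suc.IH by simp
  qed
  have "a * prob {\<omega> \<in> space M. \<exists>k\<le>n. a \<le> Z k \<omega>} = expectation (\<lambda>\<omega>. a * indicator (space M - A n) \<omega>)"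
  proof -
    have "{\<omega> \<in> space M. \<exists>k\<le>n. a \<le> Z k \<omega>} = space M - A n" by (auto simp: A_def not_less)
    then show ?thesis by simp
  qed
  \<comment> \<open>As in Markov's inequality: \<open>U n\<close> equals \<open>a\<close> where the
    level has been reached and is nonnegative elsewhere.\<close>
  also have "\<dots> \<le> expectation (U n)"
  proof (rule integral_mono[OF _ iU])
    show "integrable M (\<lambda>\<omega>. a * indicator (space M - A n) \<omega>)"
      by (auto simp: less_top[symmetric])
  qed (use nonneg in \<open>auto simp: U_def indicator_def\<close>)
  finally show ?thesis using U[of n] by linarith
qed

text \<open>The events of reaching the level by time \<open>n\<close> increase to the event of ever
  reaching it, so the finite inequality passes to the limit by continuity of the probability from
  below.\<close>

lemma (in prob_space) maximal_inequality:
  fixes F :: "nat \<Rightarrow> 'a measure" and Z :: "nat \<Rightarrow> 'a \<Rightarrow> real"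
  assumes sub: "\<And>n. subalgebra M (F n)" and mono: "\<And>n. sets (F n) \<subseteq> sets (F (Suc n))"
    and Z: "\<And>n. Z n \<in> borel_measurable (F n)" and int: "\<And>n. integrable M (Z n)"
    and nonneg: "\<And>n \<omega>. \<omega> \<in> space M \<Longrightarrow> 0 \<le> Z n \<omega>"
    and step: "\<And>n A. A \<in> sets (F n) \<Longrightarrow>
      expectation (\<lambda>\<omega>. Z (Suc n) \<omega> * indicator A \<omega>) \<le> expectation (\<lambda>\<omega>. Z n \<omega> * indicator A \<omega>) + b n"
    and a: "0 \<le> a" and B: "\<And>n. expectation (Z 0) + (\<Sum>k<n. b k) \<le> B"
  shows "a * prob {\<omega> \<in> space M. \<exists>k. a \<le> Z k \<omega>} \<le> B"
proof -
  define D where "D n = {\<omega> \<in> space M. \<exists>k\<le>n. a \<le> Z k \<omega>}" for n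
  have [measurable]: "Z n \<in> borel_measurable M" for n
    using measurable_from_subalg[OF sub Z] .
  have "range D \<subseteq> events" unfolding D_def by auto
  moreover have "incseq D" unfolding D_def incseq_def by (auto intro: order_trans)
  moreover have "(\<Union>n. D n) = {\<omega> \<in> space M. \<exists>k. a \<le> Z k \<omega>}" unfolding D_def by auto
  ultimately have "(\<lambda>n. prob (D n)) \<longlonglongrightarrow> prob {\<omega> \<in> space M. \<exists>k. a \<le> Z k \<omega>}"
    using finite_Lim_measure_incseq[of D] by simp
  then have "(\<lambda>n. a * prob (D n)) \<longlonglongrightarrow> a * prob {\<omega> \<in> space M. \<exists>k. a \<le> Z k \<omega>}"
    by (intro tendsto_intros)
  moreover have "a * prob (D n) \<le> B" for n
  proof -
    have "a * prob (D n) \<le> expectation (Z 0) + (\<Sum>k<n. b k)"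
      unfolding D_def by (rule maximal_inequality_finite[where F=F]) (fact sub mono Z int nonneg step a)+
    then show ?thesis using B[of n] by linarith
  qed
  ultimately show ?thesis by (blast intro: LIMSEQ_le_const2)
qed

section \<open>Bets on independent variables\<close>

lemma space_past [simp]: "space (past M X n) = space M"
  unfolding past_def by (rule space_measure_of) auto

lemma sets_past:
  "sets (past M X n) = sigma_sets (space M) (\<Union>i\<in>{1..<n}. {X i -` A \<inter> space M | A. A \<in> sets borel})"
  unfolding past_def by (rule sets_measure_of) auto

lemma sets_past_mono: "k \<le> n \<Longrightarrow> sets (past M X k) \<subseteq> sets (past M X n)"
  unfolding sets_past by (rule sigma_sets_mono', rule UN_mono) (simp_all add: subset_eq)

lemma past_measurable:
  assumes "1 \<le> k" "k < n"
  shows "X k \<in> borel_measurable (past M X n)"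
proof (rule measurableI)
  fix A :: "real set" assume "A \<in> sets borel"
  then have "X k -` A \<inter> space M \<in> (\<Union>i\<in>{1..<n}. {X i -` A \<inter> space M | A. A \<in> sets borel})"
    using assms by (intro UN_I[of k]) auto
  then show "X k -` A \<inter> space (past M X n) \<in> sets (past M X n)"
    unfolding sets_past space_past by (rule sigma_sets.Basic)
qed simp

lemma bounded_measurable_past_mono:
  assumes "bounded_measurable (past M X k) f" "k \<le> n"
  shows "bounded_measurable (past M X n) f"
proof (rule bounded_measurable_subalgebra[OF _ assms(1)])
  show "subalgebra (past M X n) (past M X k)"
    unfolding subalgebra_def space_past using sets_past_mono[OF assms(2), of M X] by (intro conjI refl)
qed

text \<open>Records the law of the observations through their range and their first two moments:
  \<open>m\<close> is the mean and \<open>s\<close> the variance.\<close>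

locale bounded_independent = prob_space M for M :: "'a measure" +
  fixes X :: "nat \<Rightarrow> 'a \<Rightarrow> real" and m s :: real
  assumes indep: "indep_vars (\<lambda>_. borel) X {1..}"
    and range: "\<And>n \<omega>. 1 \<le> n \<Longrightarrow> \<omega> \<in> space M \<Longrightarrow> X n \<omega> \<in> {0..1}"
    and mean: "\<And>n. 1 \<le> n \<Longrightarrow> expectation (X n) = m"
    and var: "\<And>n. 1 \<le> n \<Longrightarrow> expectation (\<lambda>\<omega>. (X n \<omega> - m)\<^sup>2) = s"
begin

text \<open>Shifting the index makes \<open>F n\<close> the information carried by
  \<open>X 1, \<dots>, X n\<close>. A stake \<open>l n\<close> measurable for \<open>F n\<close> is
  placed on \<open>X (Suc n)\<close>, so sums and products can start at 0.\<close>

abbreviation F :: "nat \<Rightarrow> 'a measure" where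
  "F n \<equiv> past M X (Suc n)"

lemma X_measurable:
  assumes "1 \<le> n"
  shows "X n \<in> borel_measurable M"
proof -
  have "\<forall>i\<in>{1..}. X i \<in> borel_measurable M"
    using indep unfolding indep_vars_def by (rule conjunct1)
  then show ?thesis using assms by simp
qed

lemma subalgebra_past: "subalgebra M (past M X n)"
  unfolding subalgebra_def space_past sets_past
proof (intro conjI refl sets.sigma_sets_subset UN_least subsetI)
  fix i B assume "i \<in> {1..<n}" "B \<in> {X i -` A \<inter> space M | A. A \<in> sets borel}"
  then show "B \<in> sets M"
    using measurable_sets[OF X_measurable[of i]] by auto
qed

lemma bounded_X:
  assumes "1 \<le> n"
  shows "bounded_measurable M (\<lambda>\<omega>. X n \<omega> - m)"
proof (rule bounded_measurable_diff[OF _ bounded_measurable_const])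
  show "bounded_measurable M (X n)"
    using range[OF assms] X_measurable[OF assms] by (intro bounded_measurableI[where B=1]) auto
qed

lemma bounded_past_X:
  assumes "1 \<le> k" "k < n"
  shows "bounded_measurable (past M X n) (\<lambda>\<omega>. X k \<omega> - m)"
proof (rule bounded_measurable_diff[OF _ bounded_measurable_const])
  show "bounded_measurable (past M X n) (X k)"
    using range[OF assms(1)] past_measurable[OF assms, of X M]
    by (intro bounded_measurableI[where B=1]) auto
qed

lemma mean_range: "0 \<le> m" "m \<le> 1"
proof -
  have i: "integrable M (X 1)"
    using range[of 1] X_measurable[of 1] by (intro integrable_const_bound[where B=1]) auto
  have "expectation (X 1) \<le> expectation (\<lambda>_. 1)"
    using range[of 1] by (intro integral_mono i) auto
  then show "m \<le> 1" using mean[of 1] by (simp add: prob_space)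
  have "0 \<le> expectation (X 1)"
    using range[of 1] by (intro integral_nonneg_AE) auto
  then show "0 \<le> m" using mean[of 1] by simp
qed

lemma X_bound: "1 \<le> n \<Longrightarrow> \<omega> \<in> space M \<Longrightarrow> \<bar>X n \<omega> - m\<bar> \<le> 1"
  using range[of n \<omega>] mean_range by auto

text \<open>Disjoint blocks of independent families that are stable under intersection generate
  independent sigma-algebras. The blocks are the indices below \<open>n\<close> and \<open>n\<close>
  itself.\<close>

lemma indep_past:
  assumes "1 \<le> n"
  shows "indep_set (sets (past M X n)) (sigma_sets (space M) {X n -` A \<inter> space M | A. A \<in> sets borel})"
proof -
  have E: "indep_sets (\<lambda>i. {X i -` A \<inter> space M | A. A \<in> sets borel}) {1..}"
    using indep unfolding indep_vars_def2 by auto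
  \<comment> \<open>\<open>True\<close> stands for the past and \<open>False\<close> for the
    present, matching the order of arguments in \<open>indep_set\<close>.\<close>
  let ?I = "case_bool {1..<n} {n}"
  have "indep_sets (\<lambda>j. sigma_sets (space M) (\<Union>i\<in>?I j. {X i -` A \<inter> space M | A. A \<in> sets borel})) UNIV"
  proof (rule indep_sets_collect_sigma)
    show "indep_sets (\<lambda>i. {X i -` A \<inter> space M | A. A \<in> sets borel}) (\<Union>j\<in>UNIV. ?I j)"
      using assms by (intro indep_sets_mono_index[OF _ E]) (auto split: bool.splits)
    show "Int_stable {X i -` A \<inter> space M | A. A \<in> sets borel}" for i
    proof (rule Int_stableI, safe)
      fix A B :: "real set" assume "A \<in> sets borel" "B \<in> sets borel"
      then show "\<exists>C. X i -` A \<inter> space M \<inter> (X i -` B \<inter> space M) = X i -` C \<inter> space M \<and> C \<in> sets borel"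
        by (intro exI[of _ "A \<inter> B"]) auto
    qed
    show "disjoint_family_on ?I UNIV"
      by (auto simp: disjoint_family_on_def split: bool.splits)
  qed
  then show ?thesis
    unfolding indep_set_def sets_past by (rule indep_sets_mono_sets) (auto split: bool.split)
qed

text \<open>The sigma-algebras generated by \<open>g\<close> and by \<open>h (X (Suc n))\<close> lie
  inside \<open>F n\<close> and the one generated by \<open>X (Suc n)\<close>, and so inherit
  independence. Taking \<open>h\<close> centred or squared gives the two conditional moments of an
  increment.\<close>

lemma expectation_past_mult:
  assumes g: "bounded_measurable (F n) g" and h: "h \<in> borel_measurable borel"
    and i: "integrable M (\<lambda>\<omega>. h (X (Suc n) \<omega>))"
  shows "expectation (\<lambda>\<omega>. g \<omega> * h (X (Suc n) \<omega>)) = expectation g * expectation (\<lambda>\<omega>. h (X (Suc n) \<omega>))"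
proof (rule indep_var_lebesgue_integral)
  have gF: "g \<in> borel_measurable (F n)" using g by (simp add: bounded_measurable_def)
  have X: "X (Suc n) \<in> borel_measurable M" by (rule X_measurable) simp
  show "indep_var borel g borel (\<lambda>\<omega>. h (X (Suc n) \<omega>))"
    unfolding indep_var_eq
  proof (intro conjI)
    show "g \<in> borel_measurable M"
      using measurable_from_subalg[OF subalgebra_past gF] .
    show "(\<lambda>\<omega>. h (X (Suc n) \<omega>)) \<in> borel_measurable M" using X h by simp
    have "indep_set (sets (F n)) (sigma_sets (space M) {X (Suc n) -` A \<inter> space M | A. A \<in> sets borel})"
      by (rule indep_past) simp
    moreover have "sigma_sets (space M) {g -` A \<inter> space M | A. A \<in> sets borel} \<subseteq> sets (F n)"
      using sets.sigma_sets_subset[of "{g -` A \<inter> space M | A. A \<in> sets borel}" "F n"]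
        measurable_sets[OF gF] by auto
    moreover have "sigma_sets (space M) {(\<lambda>\<omega>. h (X (Suc n) \<omega>)) -` A \<inter> space M | A. A \<in> sets borel}
      \<subseteq> sigma_sets (space M) {X (Suc n) -` A \<inter> space M | A. A \<in> sets borel}"
    proof (rule sigma_sets_mono', safe)
      fix A :: "real set" assume "A \<in> sets borel"
      then show "\<exists>B. (\<lambda>\<omega>. h (X (Suc n) \<omega>)) -` A \<inter> space M = X (Suc n) -` B \<inter> space M \<and> B \<in> sets borel"
        using measurable_sets[OF h, of A] by (intro exI[of _ "h -` A"]) auto
    qed
    ultimately show "indep_set (sigma_sets (space M) {g -` A \<inter> space M | A. A \<in> sets borel})
      (sigma_sets (space M) {(\<lambda>\<omega>. h (X (Suc n) \<omega>)) -` A \<inter> space M | A. A \<in> sets borel})"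
      unfolding indep_set_def
      by (elim indep_sets_mono_sets) (auto split: bool.split)
  qed
  show "integrable M g"
    by (rule bounded_measurable_integrable[OF bounded_measurable_subalgebra[OF subalgebra_past g]])
qed (rule i)

text \<open>The martingale difference property, tested against bounded functions of the past instead
  of stated by conditional expectation.\<close>

lemma expectation_past_centered:
  assumes "bounded_measurable (F n) g"
  shows "expectation (\<lambda>\<omega>. g \<omega> * (X (Suc n) \<omega> - m)) = 0"
proof -
  have i: "integrable M (\<lambda>\<omega>. X (Suc n) \<omega> - m)"
    by (rule bounded_measurable_integrable[OF bounded_X]) simp
  then have "integrable M (\<lambda>\<omega>. (X (Suc n) \<omega> - m) + m)"
    by (rule Bochner_Integration.integrable_add) simp
  then have "integrable M (X (Suc n))" by simp
  then have "expectation (\<lambda>\<omega>. X (Suc n) \<omega> - m) = 0"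
    using mean[of "Suc n"] by (simp add: prob_space)
  then show ?thesis using expectation_past_mult[OF assms, of "\<lambda>x. x - m"] i by simp
qed

lemma expectation_past_square:
  assumes "bounded_measurable (F n) g"
  shows "expectation (\<lambda>\<omega>. g \<omega> * (X (Suc n) \<omega> - m)\<^sup>2) = s * expectation g"
proof -
  have "integrable M (\<lambda>\<omega>. (X (Suc n) \<omega> - m)\<^sup>2)"
    by (rule bounded_measurable_integrable[OF bounded_measurable_power[OF bounded_X]]) simp
  then show ?thesis
    using expectation_past_mult[OF assms, of "\<lambda>x. (x - m)\<^sup>2"] var[of "Suc n"] by (simp add: mult.commute)
qed

lemma past_bounded_integrable: "bounded_measurable (past M X n) f \<Longrightarrow> integrable M f"
  by (rule bounded_measurable_integrable[OF bounded_measurable_subalgebra[OF subalgebra_past]])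

lemma bounded_past_increment:
  assumes "\<And>n. bounded_measurable (F n) (l n)" "k < n"
  shows "bounded_measurable (F n) (\<lambda>\<omega>. l k \<omega> * (X (Suc k) \<omega> - m))"
proof (rule bounded_measurable_mult)
  show "bounded_measurable (F n) (l k)"
    by (rule bounded_measurable_past_mono[OF assms(1)]) (use assms(2) in simp)
  show "bounded_measurable (F n) (\<lambda>\<omega>. X (Suc k) \<omega> - m)"
    by (rule bounded_past_X) (use assms(2) in simp_all)
qed

text \<open>The maximal inequality for the square of the martingale \<open>S\<close>. Its expected
  growth at step \<open>n\<close> is at most \<open>s\<close> times the expected square of
  \<open>l n\<close>.\<close>

lemma kolmogorov_inequality:
  fixes e B :: real and l :: "nat \<Rightarrow> 'a \<Rightarrow> real"
  assumes l: "\<And>n. bounded_measurable (F n) (l n)" and e: "0 \<le> e"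
    and B: "\<And>n. (\<Sum>k<n. expectation (\<lambda>\<omega>. (l k \<omega>)\<^sup>2)) \<le> B" and s: "0 \<le> s"
  shows "e\<^sup>2 * prob {\<omega> \<in> space M. \<exists>n. e \<le> \<bar>\<Sum>k<n. l k \<omega> * (X (Suc k) \<omega> - m)\<bar>} \<le> s * B"
proof -
  define S where "S n \<omega> = (\<Sum>k<n. l k \<omega> * (X (Suc k) \<omega> - m))" for n \<omega>
  have S: "bounded_measurable (F n) (S n)" for n
    unfolding S_def by (rule bounded_measurable_sum) (auto intro: bounded_past_increment[OF l])
  have Z: "bounded_measurable (F n) (\<lambda>\<omega>. (S n \<omega>)\<^sup>2)" for n
    by (rule bounded_measurable_power[OF S])
  have "e\<^sup>2 * prob {\<omega> \<in> space M. \<exists>n. e\<^sup>2 \<le> (S n \<omega>)\<^sup>2} \<le> s * B"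
  proof (rule maximal_inequality[where F=F and b="\<lambda>n. s * expectation (\<lambda>\<omega>. (l n \<omega>)\<^sup>2)"])
    show "subalgebra M (F n)" for n by (rule subalgebra_past)
    show "sets (F n) \<subseteq> sets (F (Suc n))" for n by (rule sets_past_mono) simp
    show "(\<lambda>\<omega>. (S n \<omega>)\<^sup>2) \<in> borel_measurable (F n)" for n
      using Z[of n] unfolding bounded_measurable_def by blast
    show "integrable M (\<lambda>\<omega>. (S n \<omega>)\<^sup>2)" for n by (rule past_bounded_integrable[OF Z])
    show "expectation (\<lambda>\<omega>. (S 0 \<omega>)\<^sup>2) + (\<Sum>k<n. s * expectation (\<lambda>\<omega>. (l k \<omega>)\<^sup>2)) \<le> s * B" for n
      using mult_left_mono[OF B[of n] s] by (simp add: S_def sum_distrib_left)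
  next
    fix n A assume A: "A \<in> sets (F n)"
    note bA = bounded_measurable_indicator[OF A]
    let ?u = "\<lambda>\<omega>. (S n \<omega>)\<^sup>2 * indicator A \<omega>"
    let ?g = "\<lambda>\<omega>. 2 * (S n \<omega> * l n \<omega> * indicator A \<omega>)"
    let ?h = "\<lambda>\<omega>. (l n \<omega>)\<^sup>2 * indicator A \<omega>"
    have u: "bounded_measurable (F n) ?u" by (rule bounded_measurable_mult[OF Z bA])
    have g: "bounded_measurable (F n) ?g"
      by (intro bounded_measurable_mult bounded_measurable_const S l bA)
    have h: "bounded_measurable (F n) ?h"
      by (rule bounded_measurable_mult[OF bounded_measurable_power[OF l] bA])
    have bX: "bounded_measurable M (\<lambda>\<omega>. X (Suc n) \<omega> - m)" by (rule bounded_X) simp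
    have iu: "integrable M ?u" by (rule past_bounded_integrable[OF u])
    have ig: "integrable M (\<lambda>\<omega>. ?g \<omega> * (X (Suc n) \<omega> - m))"
      by (rule bounded_measurable_integrable[OF bounded_measurable_mult[OF bounded_measurable_subalgebra[OF subalgebra_past g] bX]])
    have ih: "integrable M (\<lambda>\<omega>. ?h \<omega> * (X (Suc n) \<omega> - m)\<^sup>2)"
      by (rule bounded_measurable_integrable[OF bounded_measurable_mult[OF bounded_measurable_subalgebra[OF subalgebra_past h] bounded_measurable_power[OF bX]]])
    \<comment> \<open>Expanding the square puts the cross term in the form \<open>?g\<close> times a
      centred variable with \<open>?g\<close> known at time \<open>n\<close>, so its expectation
      vanishes.\<close>
    have "(\<lambda>\<omega>. (S (Suc n) \<omega>)\<^sup>2 * indicator A \<omega>)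
      = (\<lambda>\<omega>. (?u \<omega> + ?g \<omega> * (X (Suc n) \<omega> - m)) + ?h \<omega> * (X (Suc n) \<omega> - m)\<^sup>2)"
      by (rule ext) (simp add: S_def power2_eq_square algebra_simps)
    then have "expectation (\<lambda>\<omega>. (S (Suc n) \<omega>)\<^sup>2 * indicator A \<omega>)
      = expectation ?u + expectation (\<lambda>\<omega>. ?g \<omega> * (X (Suc n) \<omega> - m)) + expectation (\<lambda>\<omega>. ?h \<omega> * (X (Suc n) \<omega> - m)\<^sup>2)"
      using iu ig ih by simp
    also have "\<dots> = expectation ?u + s * expectation ?h"
      unfolding expectation_past_centered[OF g] expectation_past_square[OF h] by simp
    also have "expectation ?h \<le> expectation (\<lambda>\<omega>. (l n \<omega>)\<^sup>2)"
      by (intro integral_mono past_bounded_integrable[OF h] past_bounded_integrable[OF bounded_measurable_power[OF l]])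
        (auto simp: indicator_def)
    finally show "expectation (\<lambda>\<omega>. (S (Suc n) \<omega>)\<^sup>2 * indicator A \<omega>)
      \<le> expectation ?u + s * expectation (\<lambda>\<omega>. (l n \<omega>)\<^sup>2)"
      using s by (simp add: mult_left_mono)
  qed auto
  moreover have "e\<^sup>2 \<le> (S n \<omega>)\<^sup>2 \<longleftrightarrow> e \<le> \<bar>S n \<omega>\<bar>" for n \<omega>
    using abs_le_square_iff[of e "S n \<omega>"] e by simp
  ultimately show ?thesis by (simp add: S_def)
qed

section \<open>Almost sure convergence of the sum of the increments\<close>

lemma var_nonneg: "0 \<le> s"
  using var[of 1] by (metis Bochner_Integration.integral_nonneg le_refl zero_le_power2)

text \<open>Kolmogorov's inequality is applied to the increments from index \<open>j\<close> on.
  Their total variance tends to 0 as \<open>j\<close> grows, so almost surely, for every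
  \<open>e\<close>, the sums started at some \<open>j\<close> stay below \<open>e\<close>; the
  partial sums are therefore Cauchy.\<close>

lemma AE_summable_if_bounded_squares:
  fixes l :: "nat \<Rightarrow> 'a \<Rightarrow> real"
  assumes l: "\<And>n. bounded_measurable (F n) (l n)"
    and N: "\<And>n \<omega>. \<omega> \<in> space M \<Longrightarrow> (\<Sum>k<n. (l k \<omega>)\<^sup>2) \<le> N"
  shows "AE \<omega> in M. summable (\<lambda>k. l k \<omega> * (X (Suc k) \<omega> - m))"
proof -
  define c where "c k = expectation (\<lambda>\<omega>. (l k \<omega>)\<^sup>2)" for k
  have il: "integrable M (\<lambda>\<omega>. (l k \<omega>)\<^sup>2)" for k
    by (rule past_bounded_integrable[OF bounded_measurable_power[OF l]])
  have c0: "0 \<le> c k" for k unfolding c_def by simp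
  have "(\<Sum>k<n. c k) \<le> N" for n
  proof -
    have "(\<Sum>k<n. c k) = expectation (\<lambda>\<omega>. \<Sum>k<n. (l k \<omega>)\<^sup>2)"
      unfolding c_def using il by simp
    also have "\<dots> \<le> expectation (\<lambda>_. N)"
      using il N by (intro integral_mono) auto
    finally show ?thesis by (simp add: prob_space)
  qed
  then have sc: "summable c" using c0 by (rule summableI_nonneg_bounded[rotated])
  \<comment> \<open>The tail of the expected squares, which tends to 0 because the uniform bound
    \<open>N\<close> makes these expectations summable.\<close>
  define T where "T j = suminf c - (\<Sum>k<j. c k)" for j
  have "T \<longlonglongrightarrow> suminf c - suminf c"
    unfolding T_def by (intro tendsto_intros summable_LIMSEQ sc)
  then have T0: "T \<longlonglongrightarrow> 0" by simp
  define y where "y k \<omega> = l k \<omega> * (X (Suc k) \<omega> - m)" for k \<omega>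
  define t where "t j k \<omega> = (if j \<le> k then l k \<omega> else 0)" for j k \<omega>
  have tb: "bounded_measurable (F k) (t j k)" for j k
    unfolding t_def using l by (cases "j \<le> k") (auto intro: bounded_measurable_const)
  have tT: "(\<Sum>k<n. expectation (\<lambda>\<omega>. (t j k \<omega>)\<^sup>2)) \<le> T j" for j n
  proof -
    have "(\<Sum>k<n. expectation (\<lambda>\<omega>. (t j k \<omega>)\<^sup>2)) = (\<Sum>k<n. if k \<in> {j..} then c k else 0)"
      by (rule sum.cong) (auto simp: t_def c_def)
    also have "\<dots> = sum c ({..<n} \<inter> {j..})" by (rule sum.inter_restrict[symmetric]) simp
    \<comment> \<open>Adding back the head turns the claim into a finite sum of nonnegative terms
      bounded by the whole series. This also covers \<open>n < j\<close>.\<close>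
    also have "\<dots> + (\<Sum>k<j. c k) = sum c (({..<n} \<inter> {j..}) \<union> {..<j})"
      by (rule sum.union_disjoint[symmetric]) auto
    also have "\<dots> \<le> suminf c" by (rule sum_le_suminf[OF sc]) (auto simp: c0)
    finally show ?thesis by (simp add: T_def)
  qed
  have ty: "(\<Sum>k<n. t j k \<omega> * (X (Suc k) \<omega> - m)) = (\<Sum>k<n. y k \<omega>) - (\<Sum>k<j. y k \<omega>)" if "j \<le> n" for j n \<omega>
  proof -
    have "(\<Sum>k<n. t j k \<omega> * (X (Suc k) \<omega> - m)) = (\<Sum>k<n. if k \<in> {j..} then y k \<omega> else 0)"
      by (rule sum.cong) (auto simp: t_def y_def)
    also have "\<dots> = (\<Sum>k\<in>{..<n} \<inter> {j..}. y k \<omega>)" by (rule sum.inter_restrict[symmetric]) simp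
    also have "{..<n} \<inter> {j..} = {..<n} - {..<j}" by auto
    also have "(\<Sum>k\<in>{..<n} - {..<j}. y k \<omega>) = (\<Sum>k<n. y k \<omega>) - (\<Sum>k<j. y k \<omega>)"
      using that by (intro sum_diff) auto
    finally show ?thesis .
  qed
  have ym: "y k \<in> borel_measurable M" for k
  proof -
    have "bounded_measurable (F (Suc k)) (y k)"
      unfolding y_def by (rule bounded_past_increment[OF l]) simp
    then show ?thesis
      using bounded_measurable_subalgebra[OF subalgebra_past] unfolding bounded_measurable_def by blast
  qed
  have tm: "(\<lambda>\<omega>. t j k \<omega> * (X (Suc k) \<omega> - m)) \<in> borel_measurable M" for j k
    using ym[of k] unfolding t_def y_def[abs_def] by (cases "j \<le> k") simp_all
  have small: "AE \<omega> in M. \<exists>j. \<forall>n. \<bar>\<Sum>k<n. t j k \<omega> * (X (Suc k) \<omega> - m)\<bar> < e" if e: "0 < e" for e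
  proof -
    define D where "D j = {\<omega> \<in> space M. \<exists>n. e \<le> \<bar>\<Sum>k<n. t j k \<omega> * (X (Suc k) \<omega> - m)\<bar>}" for j
    have D: "D j \<in> events" for j unfolding D_def using tm by measurable
    \<comment> \<open>The exceptional event: from every starting index the sum reaches
      \<open>e\<close> in absolute value. It lies in each \<open>D j\<close>, so its probability is
      at most \<open>s * T j / e\<^sup>2\<close> for all \<open>j\<close>.\<close>
    define E where "E = (\<Inter>j. D j)"
    have E: "E \<in> events" unfolding E_def using D by auto
    have "prob E \<le> s * T j / e\<^sup>2" for j
    proof -
      have "prob E \<le> prob (D j)" unfolding E_def by (intro finite_measure_mono D) auto
      moreover have "e\<^sup>2 * prob (D j) \<le> s * T j"
        unfolding D_def by (rule kolmogorov_inequality[OF tb _ tT var_nonneg]) (use e in simp)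
      ultimately show ?thesis using e by (smt (verit) mult_left_mono pos_le_divide_eq zero_le_power2 zero_less_power mult.commute)
    qed
    moreover have "(\<lambda>j. s * T j / e\<^sup>2) \<longlonglongrightarrow> s * 0 / e\<^sup>2" using e by (intro tendsto_intros T0) auto
    ultimately have "prob E \<le> 0" using LIMSEQ_le_const[of "\<lambda>j. s * T j / e\<^sup>2" "s * 0 / e\<^sup>2" "prob E"] by auto
    then have "prob E = 0" by (simp add: measure_le_0_iff)
    then have "AE \<omega> in M. \<omega> \<notin> E" using prob_eq_0[OF E] by simp
    then show ?thesis
    proof (rule AE_mp, intro AE_I2 impI)
      fix \<omega> assume "\<omega> \<in> space M" "\<omega> \<notin> E"
      then show "\<exists>j. \<forall>n. \<bar>\<Sum>k<n. t j k \<omega> * (X (Suc k) \<omega> - m)\<bar> < e"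
        unfolding E_def D_def by (auto simp: not_le)
    qed
  qed
  \<comment> \<open>Countably many thresholds suffice, which keeps the exceptional set null.\<close>
  have "AE \<omega> in M. \<forall>i. \<exists>j. \<forall>n. \<bar>\<Sum>k<n. t j k \<omega> * (X (Suc k) \<omega> - m)\<bar> < inverse (real (Suc i))"
    unfolding AE_all_countable by (intro allI small) simp
  then show ?thesis
  proof (rule AE_mp, intro AE_I2 impI)
    fix \<omega> assume H: "\<forall>i. \<exists>j. \<forall>n. \<bar>\<Sum>k<n. t j k \<omega> * (X (Suc k) \<omega> - m)\<bar> < inverse (real (Suc i))"
    have "Cauchy (\<lambda>n. \<Sum>k<n. y k \<omega>)"
    proof (rule metric_CauchyI)
      fix e :: real assume "0 < e"
      then obtain i where i: "inverse (real (Suc i)) < e / 2"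
        using reals_Archimedean[of "e / 2"] by auto
      obtain j where "\<And>n. \<bar>\<Sum>k<n. t j k \<omega> * (X (Suc k) \<omega> - m)\<bar> < inverse (real (Suc i))" using H by blast
      then have j: "\<bar>(\<Sum>k<n. y k \<omega>) - (\<Sum>k<j. y k \<omega>)\<bar> < e / 2" if "j \<le> n" for n
        using i ty[OF that] by (metis order_less_trans)
      show "\<exists>J. \<forall>p\<ge>J. \<forall>n\<ge>J. dist (\<Sum>k<p. y k \<omega>) (\<Sum>k<n. y k \<omega>) < e"
      proof (intro exI[of _ j] allI impI)
        fix p n assume "j \<le> p" "j \<le> n"
        then show "dist (\<Sum>k<p. y k \<omega>) (\<Sum>k<n. y k \<omega>) < e"
          using j[of p] j[of n] unfolding dist_real_def by linarith
      qed
    qed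
    then show "summable (\<lambda>k. l k \<omega> * (X (Suc k) \<omega> - m))"
      unfolding summable_iff_convergent y_def by (simp add: Cauchy_convergent_iff)
  qed
qed

text \<open>Localization: for each \<open>N\<close> the truncated stakes satisfy the preceding
  lemma, and a path with summable squares is not truncated at all for large
  \<open>N\<close>.\<close>

lemma AE_summable_if_summable_squares:
  fixes l :: "nat \<Rightarrow> 'a \<Rightarrow> real"
  assumes l: "\<And>n. bounded_measurable (F n) (l n)"
  shows "AE \<omega> in M. summable (\<lambda>k. (l k \<omega>)\<^sup>2) \<longrightarrow> summable (\<lambda>k. l k \<omega> * (X (Suc k) \<omega> - m))"
proof -
  \<comment> \<open>The sum includes index \<open>k\<close> itself, which is possible because
    \<open>l k\<close> is known at time \<open>k\<close>. The truncated squares thus never overshoot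
    \<open>N\<close>.\<close>
  define G where "G N k = {\<omega> \<in> space M. (\<Sum>i\<le>k. (l i \<omega>)\<^sup>2) \<le> real N}" for N k
  define t where "t N k \<omega> = l k \<omega> * indicator (G N k) \<omega>" for N k \<omega>
  have GF: "G N k \<in> sets (F k)" for N k
  proof -
    have "bounded_measurable (F k) (\<lambda>\<omega>. \<Sum>i\<le>k. (l i \<omega>)\<^sup>2)"
      by (rule bounded_measurable_sum[OF bounded_measurable_power[OF bounded_measurable_past_mono[OF l]]]) simp
    then have [measurable]: "(\<lambda>\<omega>. \<Sum>i\<le>k. (l i \<omega>)\<^sup>2) \<in> borel_measurable (F k)"
      unfolding bounded_measurable_def by blast
    have "{\<omega> \<in> space (F k). (\<Sum>i\<le>k. (l i \<omega>)\<^sup>2) \<le> real N} \<in> sets (F k)" by measurable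
    then show ?thesis by (simp add: G_def)
  qed
  have "AE \<omega> in M. \<forall>N. summable (\<lambda>k. t N k \<omega> * (X (Suc k) \<omega> - m))"
    unfolding AE_all_countable
  proof (intro allI AE_summable_if_bounded_squares)
    show "bounded_measurable (F n) (t N n)" for N n
      unfolding t_def by (rule bounded_measurable_mult[OF l bounded_measurable_indicator[OF GF]])
    show "(\<Sum>k<n. (t N k \<omega>)\<^sup>2) \<le> real N" if "\<omega> \<in> space M" for N n \<omega>
    proof (induction n)
      case (Suc n)
      \<comment> \<open>On \<open>G N n\<close> even the sum of the original squares through
        \<open>n\<close> is at most \<open>N\<close>; off it the new term is zero and the induction
        hypothesis applies.\<close>
      show ?case
      proof (cases "\<omega> \<in> G N n")
        case True
        have "(\<Sum>k<Suc n. (t N k \<omega>)\<^sup>2) \<le> (\<Sum>k<Suc n. (l k \<omega>)\<^sup>2)"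
          by (rule sum_mono) (simp add: t_def indicator_def)
        also have "\<dots> \<le> real N" using True by (simp add: G_def lessThan_Suc_atMost)
        finally show ?thesis .
      qed (use Suc in \<open>simp add: t_def\<close>)
    qed simp
  qed
  then show ?thesis
  proof (rule AE_mp, intro AE_I2 impI)
    fix \<omega> assume \<omega>: "\<omega> \<in> space M" and H: "\<forall>N. summable (\<lambda>k. t N k \<omega> * (X (Suc k) \<omega> - m))"
      and sm: "summable (\<lambda>k. (l k \<omega>)\<^sup>2)"
    obtain N :: nat where N: "(\<Sum>k. (l k \<omega>)\<^sup>2) \<le> real N" using real_arch_simple by blast
    have "(\<Sum>i\<le>k. (l i \<omega>)\<^sup>2) \<le> real N" for k
      using sum_le_suminf[OF sm, of "{..k}"] N by auto
    then have "t N k \<omega> = l k \<omega>" for k using \<omega> by (simp add: t_def G_def)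
    then show "summable (\<lambda>k. l k \<omega> * (X (Suc k) \<omega> - m))" using H[rule_format, of N] by simp
  qed
qed

text \<open>Taking the square root costs an average drift of at least \<open>d\<close> times the
  squared stake per factor. Compensating it by an exponential leaves a process that stays almost
  surely bounded, so the root of the product decays at least as fast as
  \<open>exp (- (d * Q n))\<close>.\<close>

lemma AE_prod_tendsto_0:
  fixes l :: "nat \<Rightarrow> 'a \<Rightarrow> real" and C :: real
  assumes l: "\<And>n. bounded_measurable (F n) (l n)" and s: "0 < s"
    and C: "\<And>k \<omega>. \<omega> \<in> space M \<Longrightarrow> \<bar>l k \<omega>\<bar> \<le> C"
    and y: "\<And>k \<omega>. \<omega> \<in> space M \<Longrightarrow> -1 \<le> l k \<omega> * (X (Suc k) \<omega> - m)"
  shows "AE \<omega> in M. \<not> summable (\<lambda>k. (l k \<omega>)\<^sup>2) \<longrightarrow>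
    (\<lambda>n. \<Prod>k<n. 1 + l k \<omega> * (X (Suc k) \<omega> - m)) \<longlonglongrightarrow> 0"
proof -
  have C0: "0 \<le> C" using C not_empty by (meson abs_ge_zero ex_in_conv order_trans)
  \<comment> \<open>The constant of the square root inequality; \<open>C\<close> bounds every
    \<open>y k\<close> from above because |X - m| \<le> 1.\<close>
  define c where "c = 1 / (2 * (sqrt (1 + C) + 1)\<^sup>2)"
  have "0 < sqrt (1 + C) + 1" using C0 by (simp add: add_nonneg_pos)
  then have c: "0 < c" by (simp add: c_def)
  define d where "d = c * s"
  have d: "0 < d" using c s by (simp add: d_def)
  define y where "y k \<omega> = l k \<omega> * (X (Suc k) \<omega> - m)" for k \<omega>
  have y1: "-1 \<le> y k \<omega>" if "\<omega> \<in> space M" for k \<omega> using y[OF that] by (simp add: y_def)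
  have y0: "0 \<le> 1 + y k \<omega>" if "\<omega> \<in> space M" for k \<omega> using y1[OF that, of k] by simp
  have yC: "y k \<omega> \<le> C" if "\<omega> \<in> space M" for k \<omega>
  proof -
    have "\<bar>y k \<omega>\<bar> \<le> C * 1"
      unfolding y_def abs_mult using C[OF that] X_bound[of "Suc k" \<omega>] that C0 by (intro mult_mono) auto
    then show ?thesis by simp
  qed
  define Z where "Z n \<omega> = (\<Prod>k<n. sqrt (1 + y k \<omega>) * exp (d * (l k \<omega>)\<^sup>2))" for n \<omega>
  have ebd: "bounded_measurable (F n) (\<lambda>\<omega>. exp (d * (l n \<omega>)\<^sup>2))" for n
    by (rule bounded_measurable_continuous[OF l, of "\<lambda>x. exp (d * x\<^sup>2)"]) (intro continuous_intros)
  have Zb: "bounded_measurable (F n) (Z n)" for n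
    unfolding Z_def
  proof (rule bounded_measurable_prod, rule bounded_measurable_mult)
    fix k assume k: "k \<in> {..<n}"
    have "bounded_measurable (F n) (y k)"
      unfolding y_def using k by (intro bounded_past_increment[OF l]) simp
    then show "bounded_measurable (F n) (\<lambda>\<omega>. sqrt (1 + y k \<omega>))"
      by (rule bounded_measurable_continuous[where h="\<lambda>x. sqrt (1 + x)"]) (intro continuous_intros)
    show "bounded_measurable (F n) (\<lambda>\<omega>. exp (d * (l k \<omega>)\<^sup>2))"
      by (rule bounded_measurable_past_mono[OF ebd]) (use k in simp)
  qed
  have Z0: "0 \<le> Z n \<omega>" if "\<omega> \<in> space M" for n \<omega>
    unfolding Z_def using y0[OF that] by (intro prod_nonneg ballI mult_nonneg_nonneg) simp_all
  have ville: "a * prob {\<omega> \<in> space M. \<exists>n. a \<le> Z n \<omega>} \<le> 1" if "0 \<le> a" for a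
  proof (rule maximal_inequality[where F=F and b="\<lambda>_. 0", OF _ _ _ _ Z0 _ that])
    show "subalgebra M (F n)" for n by (rule subalgebra_past)
    show "sets (F n) \<subseteq> sets (F (Suc n))" for n by (rule sets_past_mono) simp
    show "Z n \<in> borel_measurable (F n)" for n
      using Zb[of n] unfolding bounded_measurable_def by blast
    show "integrable M (Z n)" for n by (rule past_bounded_integrable[OF Zb])
    show "expectation (Z 0) + (\<Sum>k<n. 0) \<le> 1" for n
      by (simp add: Z_def[abs_def] prob_space)
  next
    fix n A assume A: "A \<in> sets (F n)"
    note bA = bounded_measurable_indicator[OF A]
    \<comment> \<open>All of the factors of \<open>Z (Suc n)\<close> known at time \<open>n\<close>,
      times the test event; the only factor missing is the root of \<open>1 + y n\<close>.\<close>
    let ?g = "\<lambda>\<omega>. Z n \<omega> * exp (d * (l n \<omega>)\<^sup>2) * indicator A \<omega>"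
    have g: "bounded_measurable (F n) ?g"
      by (intro bounded_measurable_mult Zb ebd bA)
    have g1: "bounded_measurable (F n) (\<lambda>\<omega>. ?g \<omega> * l n \<omega> * (1/2))"
      by (intro bounded_measurable_mult g l bounded_measurable_const)
    have g2: "bounded_measurable (F n) (\<lambda>\<omega>. ?g \<omega> * (l n \<omega>)\<^sup>2 * c)"
      by (rule bounded_measurable_mult[OF bounded_measurable_mult[OF g bounded_measurable_power[OF l]] bounded_measurable_const])
    have bX: "bounded_measurable M (\<lambda>\<omega>. X (Suc n) \<omega> - m)" by (rule bounded_X) simp
    note i = past_bounded_integrable[OF g]
    have i1: "integrable M (\<lambda>\<omega>. ?g \<omega> * l n \<omega> * (1/2) * (X (Suc n) \<omega> - m))"
      by (rule bounded_measurable_integrable[OF bounded_measurable_mult[OF bounded_measurable_subalgebra[OF subalgebra_past g1] bX]])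
    have i2: "integrable M (\<lambda>\<omega>. ?g \<omega> * (l n \<omega>)\<^sup>2 * c * (X (Suc n) \<omega> - m)\<^sup>2)"
      by (rule bounded_measurable_integrable[OF bounded_measurable_mult[OF bounded_measurable_subalgebra[OF subalgebra_past g2] bounded_measurable_power[OF bX]]])
    have AM: "A \<in> events"
      using subalgebra_past[of "Suc n"] A unfolding subalgebra_def by (elim conjE subsetD)
    have iZ: "integrable M (\<lambda>\<omega>. Z k \<omega> * indicator A \<omega>)" for k
      by (rule bounded_measurable_integrable[OF bounded_measurable_mult[OF
            bounded_measurable_subalgebra[OF subalgebra_past Zb] bounded_measurable_indicator[OF AM]]])
    have "expectation (\<lambda>\<omega>. Z (Suc n) \<omega> * indicator A \<omega>)
      \<le> expectation (\<lambda>\<omega>. (?g \<omega> + ?g \<omega> * l n \<omega> * (1/2) * (X (Suc n) \<omega> - m)) - ?g \<omega> * (l n \<omega>)\<^sup>2 * c * (X (Suc n) \<omega> - m)\<^sup>2)"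
    proof (rule integral_mono[OF iZ Bochner_Integration.integrable_diff[OF Bochner_Integration.integrable_add[OF i i1] i2]])
      fix \<omega> assume \<omega>: "\<omega> \<in> space M"
      have "Z (Suc n) \<omega> * indicator A \<omega> = ?g \<omega> * sqrt (1 + y n \<omega>)" by (simp add: Z_def)
      also have "\<dots> \<le> ?g \<omega> * (1 + y n \<omega> / 2 - c * (y n \<omega>)\<^sup>2)"
        using sqrt_one_plus_le[OF y1[OF \<omega>] yC[OF \<omega>]] Z0[OF \<omega>] unfolding c_def
        by (intro mult_left_mono) (auto intro!: mult_nonneg_nonneg)
      also have "\<dots> = (?g \<omega> + ?g \<omega> * l n \<omega> * (1/2) * (X (Suc n) \<omega> - m)) - ?g \<omega> * (l n \<omega>)\<^sup>2 * c * (X (Suc n) \<omega> - m)\<^sup>2"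
        unfolding y_def power_mult_distrib by (simp add: ring_distribs mult_ac)
      finally show "Z (Suc n) \<omega> * indicator A \<omega> \<le> \<dots>" .
    qed
    also have "\<dots> = expectation ?g + expectation (\<lambda>\<omega>. ?g \<omega> * l n \<omega> * (1/2) * (X (Suc n) \<omega> - m))
        - expectation (\<lambda>\<omega>. ?g \<omega> * (l n \<omega>)\<^sup>2 * c * (X (Suc n) \<omega> - m)\<^sup>2)"
      by (subst Bochner_Integration.integral_diff[OF Bochner_Integration.integrable_add[OF i i1] i2],
          subst Bochner_Integration.integral_add[OF i i1], rule refl)
    \<comment> \<open>The linear term has mean zero, while the quadratic term retains the variance
      \<open>s\<close>: this is the strict concavity gain.\<close>
    also have "\<dots> = expectation ?g - s * expectation (\<lambda>\<omega>. ?g \<omega> * (l n \<omega>)\<^sup>2 * c)"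
      unfolding expectation_past_centered[OF g1] expectation_past_square[OF g2] by simp
    also have "\<dots> = expectation (\<lambda>\<omega>. ?g \<omega> - s * (?g \<omega> * (l n \<omega>)\<^sup>2 * c))"
      by (subst Bochner_Integration.integral_diff[OF i]) (use past_bounded_integrable[OF g2] in simp_all)
    also have "\<dots> \<le> expectation (\<lambda>\<omega>. Z n \<omega> * indicator A \<omega>)"
    proof (rule integral_mono[OF _ iZ])
      show "integrable M (\<lambda>\<omega>. ?g \<omega> - s * (?g \<omega> * (l n \<omega>)\<^sup>2 * c))"
        by (rule Bochner_Integration.integrable_diff[OF i integrable_mult_right[OF past_bounded_integrable[OF g2]]])
      fix \<omega> assume \<omega>: "\<omega> \<in> space M"
      \<comment> \<open>With \<open>d = c * s\<close> the remaining factor is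
        \<open>exp x * (1 - x)\<close>, which is at most 1 since
        \<open>1 - x \<le> exp (- x)\<close>.\<close>
      define x where "x = d * (l n \<omega>)\<^sup>2"
      have "exp x * (1 - x) \<le> exp x * exp (- x)"
        using exp_ge_add_one_self[of "- x"] by (intro mult_left_mono) auto
      then have "exp x * (1 - x) \<le> 1" by (simp add: exp_minus)
      then have "Z n \<omega> * indicator A \<omega> * (exp x * (1 - x)) \<le> Z n \<omega> * indicator A \<omega> * 1"
        using Z0[OF \<omega>] by (intro mult_left_mono) auto
      then show "?g \<omega> - s * (?g \<omega> * (l n \<omega>)\<^sup>2 * c) \<le> Z n \<omega> * indicator A \<omega>"
        by (simp add: x_def d_def algebra_simps)
    qed
    finally show "expectation (\<lambda>\<omega>. Z (Suc n) \<omega> * indicator A \<omega>) \<le> expectation (\<lambda>\<omega>. Z n \<omega> * indicator A \<omega>) + 0"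
      by simp
  qed
  have Zm: "Z n \<in> borel_measurable M" for n
    using bounded_measurable_subalgebra[OF subalgebra_past Zb[of n]] unfolding bounded_measurable_def by blast
  define D where "D a = {\<omega> \<in> space M. \<exists>n. a \<le> Z n \<omega>}" for a
  have D: "D a \<in> events" for a unfolding D_def using Zm by measurable
  \<comment> \<open>The event that \<open>Z\<close> exceeds all levels. Ville's inequality at level
    \<open>i + 1\<close> bounds its probability by the reciprocal of that level.\<close>
  define E where "E = (\<Inter>i. D (real (Suc i)))"
  have E: "E \<in> events" unfolding E_def using D by auto
  have "prob E \<le> inverse (real (Suc i))" for i
  proof -
    have "prob E \<le> prob (D (real (Suc i)))" unfolding E_def by (intro finite_measure_mono D) auto
    moreover have "real (Suc i) * prob (D (real (Suc i))) \<le> 1" unfolding D_def by (rule ville) simp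
    then have "prob (D (real (Suc i))) \<le> inverse (real (Suc i))"
      by (simp add: inverse_eq_divide pos_le_divide_eq mult.commute)
    ultimately show ?thesis by simp
  qed
  then have "prob E \<le> 0" using LIMSEQ_le_const[OF LIMSEQ_inverse_real_of_nat, of "prob E"] by blast
  then have "prob E = 0" by (simp add: measure_le_0_iff)
  then have "AE \<omega> in M. \<omega> \<notin> E" using prob_eq_0[OF E] by simp
  then show ?thesis
  proof (rule AE_mp, intro AE_I2 impI)
    fix \<omega> assume \<omega>: "\<omega> \<in> space M" and "\<omega> \<notin> E" and ns: "\<not> summable (\<lambda>k. (l k \<omega>)\<^sup>2)"
    then obtain B where B: "\<And>n. Z n \<omega> < B" unfolding E_def D_def by (auto simp: not_le)
    define Q where "Q n = (\<Sum>k<n. (l k \<omega>)\<^sup>2)" for n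
    have "filterlim Q at_top sequentially"
      unfolding Q_def by (rule not_summable_partial_sums_unbounded[OF _ ns]) simp
    then have "filterlim (\<lambda>n. d * Q n) at_top sequentially"
      by (rule filterlim_tendsto_pos_mult_at_top[OF tendsto_const d])
    then have "((\<lambda>n. exp (- (d * Q n))) \<longlongrightarrow> 0) sequentially"
      by (intro filterlim_compose[OF exp_at_bot]) (simp add: filterlim_uminus_at_bot)
    then have lim: "(\<lambda>n. B * exp (- (d * Q n))) \<longlonglongrightarrow> 0"
      using tendsto_mult_right_zero by blast
    have eq: "sqrt (\<Prod>k<n. 1 + y k \<omega>) = Z n \<omega> * exp (- (d * Q n))" for n
    proof -
      have "sqrt (\<Prod>k<n. 1 + y k \<omega>) = (\<Prod>k<n. sqrt (1 + y k \<omega>))"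
        by (induction n) (simp_all add: real_sqrt_mult)
      then have "Z n \<omega> = sqrt (\<Prod>k<n. 1 + y k \<omega>) * exp (d * Q n)"
        unfolding Z_def Q_def prod.distrib sum_distrib_left by (simp add: exp_sum)
      then show ?thesis by (simp add: exp_minus)
    qed
    have P0: "0 \<le> (\<Prod>k<n. 1 + y k \<omega>)" for n
      using y0[OF \<omega>] by (intro prod_nonneg) simp
    have "(\<lambda>n. sqrt (\<Prod>k<n. 1 + y k \<omega>)) \<longlonglongrightarrow> 0"
    proof (rule tendsto_sandwich[OF _ _ tendsto_const lim])
      show "\<forall>\<^sub>F n in sequentially. 0 \<le> sqrt (\<Prod>k<n. 1 + y k \<omega>)" using P0 by simp
      show "\<forall>\<^sub>F n in sequentially. sqrt (\<Prod>k<n. 1 + y k \<omega>) \<le> B * exp (- (d * Q n))"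
        unfolding eq using B by (auto intro!: always_eventually less_imp_le)
    qed
    \<comment> \<open>Squaring returns from the root to the product, which is nonnegative.\<close>
    then have "(\<lambda>n. (sqrt (\<Prod>k<n. 1 + y k \<omega>))\<^sup>2) \<longlonglongrightarrow> 0\<^sup>2" by (rule tendsto_power)
    then show "(\<lambda>n. \<Prod>k<n. 1 + l k \<omega> * (X (Suc k) \<omega> - m)) \<longlonglongrightarrow> 0"
      unfolding real_sqrt_pow2[OF P0] by (simp add: y_def)
  qed
qed

end

section \<open>Convergence of the wealth\<close>

text \<open>Three cases: divergent squares give limit 0; a vanishing factor makes all later products
  0; otherwise the squares of the increments are dominated by those of the stakes, the increments
  are summable, and the product has a positive limit.\<close>

lemma (in bounded_independent) AE_wealth_limit:
  fixes l :: "nat \<Rightarrow> 'a \<Rightarrow> real" and C :: real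
  assumes l: "\<And>n. bounded_measurable (F n) (l n)" and s: "0 < s"
    and C: "\<And>k \<omega>. \<omega> \<in> space M \<Longrightarrow> \<bar>l k \<omega>\<bar> \<le> C"
    and y: "\<And>k \<omega>. \<omega> \<in> space M \<Longrightarrow> -1 \<le> l k \<omega> * (X (Suc k) \<omega> - m)"
  shows "AE \<omega> in M. \<exists>L\<ge>0. (\<lambda>n. \<Prod>k<n. 1 + l k \<omega> * (X (Suc k) \<omega> - m)) \<longlonglongrightarrow> L \<and>
    (L = 0 \<longleftrightarrow> \<not> summable (\<lambda>k. (l k \<omega>)\<^sup>2) \<or> (\<exists>k. l k \<omega> * (X (Suc k) \<omega> - m) = -1))"
proof -
  have "AE \<omega> in M. \<not> summable (\<lambda>k. (l k \<omega>)\<^sup>2) \<longrightarrow> (\<lambda>n. \<Prod>k<n. 1 + l k \<omega> * (X (Suc k) \<omega> - m)) \<longlonglongrightarrow> 0"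
    using l s C y by (rule AE_prod_tendsto_0)
  then show ?thesis
    using AE_summable_if_summable_squares[OF l] AE_space
  proof eventually_elim
    case (elim \<omega>)
    define y where "y k = l k \<omega> * (X (Suc k) \<omega> - m)" for k
    consider (inf) "\<not> summable (\<lambda>k. (l k \<omega>)\<^sup>2)" | (hit) k where "y k = -1"
      | (pos) "summable (\<lambda>k. (l k \<omega>)\<^sup>2)" "\<And>k. y k \<noteq> -1" by blast
    then show ?case
    proof cases
      case inf
      then show ?thesis using elim by (intro exI[of _ 0]) simp
    next
      case (hit k)
      have "(\<Prod>i<n. 1 + y i) = 0" if "k < n" for n
        using that hit by (intro prod_zero) (auto intro!: bexI[of _ k])
      then have "\<forall>\<^sub>F n in sequentially. 0 = (\<Prod>i<n. 1 + y i)"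
        by (auto simp: eventually_sequentially intro!: exI[of _ "Suc k"])
      then have "(\<lambda>n. \<Prod>i<n. 1 + y i) \<longlonglongrightarrow> 0"
        by (rule Lim_transform_eventually[OF tendsto_const])
      then show ?thesis using hit unfolding y_def by (intro exI[of _ 0]) auto
    next
      case pos
      have "summable (\<lambda>k. (y k)\<^sup>2)"
      proof (rule summable_comparison_test'[OF pos(1)])
        fix k
        have "\<bar>X (Suc k) \<omega> - m\<bar>\<^sup>2 \<le> 1" using X_bound[of "Suc k" \<omega>] elim(3) by (intro power_le_one) auto
        then show "norm ((y k)\<^sup>2) \<le> (l k \<omega>)\<^sup>2"
          unfolding y_def by (simp add: power_mult_distrib mult_left_le)
      qed
      moreover have "0 < 1 + y k" for k using assms(4)[OF elim(3), of k] pos(2)[of k] by (simp add: y_def)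
      moreover have "summable y" using elim(2) pos(1) by (simp add: y_def[abs_def])
      ultimately obtain L where "L > 0" "(\<lambda>n. \<Prod>k<n. 1 + y k) \<longlonglongrightarrow> L"
        using prod_one_plus_tendsto_pos[of y] by blast
      then show ?thesis using pos unfolding y_def by (intro exI[of _ L]) auto
    qed
  qed
qed

section \<open>Moments of a non-degenerate law\<close>

lemma point_mass_if_AE_eq:
  assumes P: "prob_space P" "sets P = sets borel" and c: "AE x in P. x = c"
  shows "point_mass P"
  unfolding point_mass_def
proof (intro exI measure_eqI)
  fix A assume A: "A \<in> sets P"
  interpret prob_space P by (rule P)
  show "emeasure P A = emeasure (return borel c) A"
  proof (cases "c \<in> A")
    case True
    then have "AE x in P. x \<in> A" using c by (rule_tac AE_mp[OF c]) auto
    then show ?thesis using True A P(2) by (simp add: emeasure_eq_1_AE)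
  next
    case False
    then have "AE x in P. x \<notin> A" using c by (rule_tac AE_mp[OF c]) auto
    then show ?thesis using False A P(2) AE_iff_measurable[of A P "\<lambda>x. x \<notin> A"] sets.sets_into_space[OF A]
      by (auto simp: subset_eq)
  qed
qed (use P in simp)

text \<open>Each claim integrates a nonnegative function: \<open>x\<close>, \<open>1 - x\<close> and
  the squared deviation. A zero integral would make the function vanish almost surely and
  concentrate \<open>P\<close> at 0, at 1 or at \<open>m\<close>.\<close>

lemma non_degenerate_moments:
  assumes P: "prob_space P" "sets P = sets borel" and supp: "emeasure P {0..1::real} = 1"
    and nd: "\<not> point_mass P" and m: "m = (\<integral>x. x \<partial>P)"
  shows "0 < m" "m < 1" "0 < (\<integral>x. (x - m)\<^sup>2 \<partial>P)"
proof -
  interpret prob_space P by (rule P)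
  have ae: "AE x in P. x \<in> {0..1}"
    using supp P(2) by (intro AE_prob_1) (simp add: measure_def)
  have [measurable_cong]: "sets P = sets borel" by (rule P)
  have i: "integrable P (\<lambda>x. x)"
    by (rule integrable_const_bound[where B=1]) (use ae in auto)
  have "0 \<le> m" unfolding m by (rule integral_nonneg_AE) (use ae in auto)
  moreover have "m \<noteq> 0"
  proof
    assume "m = 0"
    then have "AE x in P. x = 0"
      using integral_nonneg_eq_0_iff_AE[OF i] ae m by auto
    then show False using point_mass_if_AE_eq[OF P] nd by blast
  qed
  ultimately show "0 < m" by simp
  have i1: "integrable P (\<lambda>x. 1 - x)" using i by simp
  have e1: "(\<integral>x. 1 - x \<partial>P) = 1 - m" using i m by (simp add: prob_space)
  have "0 \<le> 1 - m" unfolding e1[symmetric] by (rule integral_nonneg_AE) (use ae in auto)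
  moreover have "1 - m \<noteq> 0"
  proof
    assume "1 - m = 0"
    moreover have "AE x in P. 0 \<le> 1 - x" using ae by auto
    ultimately have "AE x in P. 1 - x = 0"
      using integral_nonneg_eq_0_iff_AE[OF i1] e1 by simp
    then have "AE x in P. x = 1" by auto
    then show False using point_mass_if_AE_eq[OF P] nd by blast
  qed
  ultimately show "m < 1" by simp
  have i2: "integrable P (\<lambda>x. (x - m)\<^sup>2)"
  proof (rule integrable_const_bound[where B=1])
    have "(x - m)\<^sup>2 \<le> 1" if "x \<in> {0..1}" for x
      using that \<open>0 < m\<close> \<open>m < 1\<close> by (auto simp: abs_square_le_1 abs_le_iff)
    then show "AE x in P. norm ((x - m)\<^sup>2) \<le> 1"
      by (intro eventually_mono[OF ae]) simp
  qed simp
  have "0 \<le> (\<integral>x. (x - m)\<^sup>2 \<partial>P)" by simp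
  moreover have "(\<integral>x. (x - m)\<^sup>2 \<partial>P) \<noteq> 0"
  proof
    assume "(\<integral>x. (x - m)\<^sup>2 \<partial>P) = 0"
    then have "AE x in P. (x - m)\<^sup>2 = 0"
      using integral_nonneg_eq_0_iff_AE[OF i2] by simp
    then have "AE x in P. x = m" by simp
    then show False using point_mass_if_AE_eq[OF P] nd by blast
  qed
  ultimately show "0 < (\<integral>x. (x - m)\<^sup>2 \<partial>P)" by linarith
qed

theorem theorem2p1:
  fixes P :: "real measure" and M :: "'a measure"
    and X lam :: "nat \<Rightarrow> 'a \<Rightarrow> real" and m :: real
  assumes P_prob: "prob_space P" and P_borel: "sets P = sets borel"
    and P_supp: "emeasure P {0..1} = 1"
    and P_nondeg: "\<not> point_mass P"
    and m_mean: "m = (\<integral>x. x \<partial>P)"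
    and M_prob: "prob_space M"
    and X_indep: "prob_space.indep_vars M (\<lambda>_. borel) X {1..}"
    and X_law: "\<And>n. n \<ge> 1 \<Longrightarrow> distr M borel (X n) = P"
    and X_range: "\<And>n \<omega>. n \<ge> 1 \<Longrightarrow> \<omega> \<in> space M \<Longrightarrow> X n \<omega> \<in> {0..1}"
    and lam_pred: "predictable M X lam"
    and lam_range: "\<And>n \<omega>. n \<ge> 1 \<Longrightarrow> \<omega> \<in> space M \<Longrightarrow> lam n \<omega> \<in> {- (1 / (1 - m))..1 / m}"
  shows "(\<exists>W. is_as_limit M (wealth m lam X) W) \<and>
    (\<forall>W. is_as_limit M (wealth m lam X) W \<longrightarrow>
      ae_eq M {\<omega> \<in> space M. W \<omega> = 0}
        ({\<omega> \<in> space M. (\<Sum>n. ennreal ((lam (Suc n) \<omega>)\<^sup>2)) = \<infinity>} \<union>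
         (\<Union>n\<in>{1..}. {\<omega> \<in> space M. lam n \<omega> * (X n \<omega> - m) = -1})) \<and>
      ae_eq M {\<omega> \<in> space M. W \<omega> > 0}
        ({\<omega> \<in> space M. (\<Sum>n. ennreal ((lam (Suc n) \<omega>)\<^sup>2)) < \<infinity>} \<inter>
         (\<Inter>n\<in>{1..}. {\<omega> \<in> space M. lam n \<omega> * (X n \<omega> - m) > -1})))"
proof -
  note moments = non_degenerate_moments[OF P_prob P_borel P_supp P_nondeg m_mean]
  define s where "s = (\<integral>x. (x - m)\<^sup>2 \<partial>P)"
  interpret prob_space M by (rule M_prob)
  have X_meas: "X n \<in> borel_measurable M" if "1 \<le> n" for n
  proof -
    have "\<forall>i\<in>{1..}. X i \<in> borel_measurable M"
      using X_indep unfolding indep_vars_def by (rule conjunct1)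
    then show ?thesis using that by simp
  qed
  interpret bounded_independent M X m s
  proof
    show "indep_vars (\<lambda>_. borel) X {1..}" by (rule X_indep)
    show "X n \<omega> \<in> {0..1}" if "1 \<le> n" "\<omega> \<in> space M" for n \<omega> by (rule X_range[OF that])
    show "expectation (X n) = m" if "1 \<le> n" for n
      using integral_distr[OF X_meas[OF that], of "\<lambda>x. x"] X_law[OF that] by (simp add: m_mean)
    show "expectation (\<lambda>\<omega>. (X n \<omega> - m)\<^sup>2) = s" if "1 \<le> n" for n
      using integral_distr[OF X_meas[OF that], of "\<lambda>x. (x - m)\<^sup>2"] X_law[OF that] by (simp add: s_def)
  qed
  \<comment> \<open>After this shift, predictability says precisely that \<open>l k\<close> is
    measurable for \<open>F k\<close>.\<close>
  define l where "l k = lam (Suc k)" for k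
  define C where "C = max (1 / (1 - m)) (1 / m)"
  have lC: "\<bar>l k \<omega>\<bar> \<le> C" if "\<omega> \<in> space M" for k \<omega>
    using lam_range[of "Suc k" \<omega>] that by (auto simp: l_def C_def abs_le_iff le_max_iff_disj)
  have lF: "l k \<in> borel_measurable (F k)" for k
    using lam_pred by (simp add: predictable_def l_def)
  have lb: "bounded_measurable (F k) (l k)" for k
    by (rule bounded_measurableI[OF lF, of _ C]) (simp add: lC)
  \<comment> \<open>For \<open>X \<ge> m\<close> the worst stake is \<open>- (1 / (1 - m))\<close>
    and the worst outcome 1; for \<open>X < m\<close> they are \<open>1 / m\<close> and 0. Both
    extremes give exactly -1.\<close>
  have y1: "-1 \<le> l k \<omega> * (X (Suc k) \<omega> - m)" if \<omega>: "\<omega> \<in> space M" for k \<omega>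
  proof (cases "m \<le> X (Suc k) \<omega>")
    case True
    have "- (1 / (1 - m)) * (1 - m) \<le> - (1 / (1 - m)) * (X (Suc k) \<omega> - m)"
      using X_range[of "Suc k" \<omega>] \<omega> moments by (intro mult_left_mono_neg) auto
    also have "\<dots> \<le> l k \<omega> * (X (Suc k) \<omega> - m)"
      using lam_range[of "Suc k" \<omega>] \<omega> True unfolding l_def by (intro mult_right_mono) auto
    finally show ?thesis using moments by simp
  next
    case False
    have "1 / m * (0 - m) \<le> 1 / m * (X (Suc k) \<omega> - m)"
      using X_range[of "Suc k" \<omega>] \<omega> moments by (intro mult_left_mono) auto
    also have "\<dots> \<le> l k \<omega> * (X (Suc k) \<omega> - m)"
      using lam_range[of "Suc k" \<omega>] \<omega> False unfolding l_def by (intro mult_right_mono_neg) auto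
    finally show ?thesis using moments by simp
  qed
  have wealth: "wealth m lam X n \<omega> = (\<Prod>k<n. 1 + l k \<omega> * (X (Suc k) \<omega> - m))" for n \<omega>
    unfolding wealth_def l_def One_nat_def by (rule prod.atLeast1_atMost_eq[unfolded One_nat_def])
  have lM: "lam n \<in> borel_measurable M" if "1 \<le> n" for n
    by (rule measurable_from_subalg[OF subalgebra_past[of n]])
      (use lam_pred that in \<open>simp add: predictable_def\<close>)
  have wM: "wealth m lam X n \<in> borel_measurable M" for n
    unfolding wealth_def[abs_def]
  proof (rule borel_measurable_prod)
    fix k assume "k \<in> {1..n}"
    then have [measurable]: "lam k \<in> borel_measurable M" "X k \<in> borel_measurable M"
      by (simp_all add: lM X_meas)
    show "(\<lambda>\<omega>. 1 + lam k \<omega> * (X k \<omega> - m)) \<in> borel_measurable M" by measurable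
  qed
  let ?S = "\<lambda>\<omega>. \<Sum>n. ennreal ((lam (Suc n) \<omega>)\<^sup>2)"
  have S: "?S \<omega> = \<infinity> \<longleftrightarrow> \<not> summable (\<lambda>k. (l k \<omega>)\<^sup>2)" for \<omega>
  proof -
    have "summable (\<lambda>k. (l k \<omega>)\<^sup>2)" if "?S \<omega> \<noteq> top"
      unfolding l_def by (rule summable_suminf_not_top[OF _ that]) simp
    moreover have "?S \<omega> \<noteq> top" if "summable (\<lambda>k. (l k \<omega>)\<^sup>2)"
      by (rule ennreal_suminf_neq_top[OF that[unfolded l_def]]) simp
    ultimately show ?thesis unfolding infinity_ennreal_def by blast
  qed
  define A0 where "A0 = {\<omega> \<in> space M. ?S \<omega> = \<infinity>} \<union> (\<Union>n\<in>{1..}. {\<omega> \<in> space M. lam n \<omega> * (X n \<omega> - m) = -1})"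
  define A1 where "A1 = {\<omega> \<in> space M. ?S \<omega> < \<infinity>} \<inter> (\<Inter>n\<in>{1..}. {\<omega> \<in> space M. lam n \<omega> * (X n \<omega> - m) > -1})"
  have ev0: "A0 \<in> events"
    unfolding A0_def
  proof (intro sets.Un sets.countable_UN'' countableI_type)
    have [measurable]: "lam (Suc n) \<in> borel_measurable M" for n by (rule lM) simp
    show "{\<omega> \<in> space M. ?S \<omega> = \<infinity>} \<in> events" by measurable
    show "{\<omega> \<in> space M. lam n \<omega> * (X n \<omega> - m) = -1} \<in> events" if "n \<in> {1..}" for n
    proof -
      have [measurable]: "lam n \<in> borel_measurable M" "X n \<in> borel_measurable M"
        using that by (simp_all add: lM X_meas)
      show ?thesis by measurable
    qed
  qed
  have mem0: "\<omega> \<in> A0 \<longleftrightarrow> \<not> summable (\<lambda>k. (l k \<omega>)\<^sup>2) \<or> (\<exists>k. l k \<omega> * (X (Suc k) \<omega> - m) = -1)"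
    if "\<omega> \<in> space M" for \<omega>
  proof -
    have "(\<exists>n\<in>{1..}. lam n \<omega> * (X n \<omega> - m) = -1) \<longleftrightarrow> (\<exists>k. l k \<omega> * (X (Suc k) \<omega> - m) = -1)"
      unfolding l_def by (metis Suc_diff_1 Suc_le_eq One_nat_def atLeast_iff zero_less_Suc)
    then show ?thesis unfolding A0_def using that S[of \<omega>] by blast
  qed
  \<comment> \<open>By \<open>y1\<close> a value other than -1 is greater than -1, so the second
    event is the exact complement of the first.\<close>
  have A1: "A1 = space M - A0"
  proof -
    have "lam n \<omega> * (X n \<omega> - m) > -1 \<longleftrightarrow> lam n \<omega> * (X n \<omega> - m) \<noteq> -1" if "n \<in> {1..}" "\<omega> \<in> space M" for n \<omega>
      using y1[of \<omega> "n - 1"] that by (auto simp: l_def)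
    moreover have "?S \<omega> < \<infinity> \<longleftrightarrow> ?S \<omega> \<noteq> \<infinity>" for \<omega> by (simp add: less_top)
    ultimately show ?thesis unfolding A0_def A1_def by auto
  qed
  have "AE \<omega> in M. \<exists>L\<ge>0. (\<lambda>n. wealth m lam X n \<omega>) \<longlonglongrightarrow> L \<and>
      (L = 0 \<longleftrightarrow> \<not> summable (\<lambda>k. (l k \<omega>)\<^sup>2) \<or> (\<exists>k. l k \<omega> * (X (Suc k) \<omega> - m) = -1))"
    unfolding wealth using lb moments(3)[folded s_def] lC y1 by (rule AE_wealth_limit)
  note main = this
  \<comment> \<open>\<open>lim\<close> is measurable on all of \<open>M\<close>, with some arbitrary
    value where the wealth diverges, and is the true limit almost everywhere.\<close>
  have ex: "is_as_limit M (wealth m lam X) (\<lambda>\<omega>. lim (\<lambda>n. wealth m lam X n \<omega>))"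
    unfolding is_as_limit_def
  proof
    show "(\<lambda>\<omega>. lim (\<lambda>n. wealth m lam X n \<omega>)) \<in> borel_measurable M"
      by (rule borel_measurable_lim_metric) (rule wM)
    show "AE \<omega> in M. (\<lambda>n. wealth m lam X n \<omega>) \<longlonglongrightarrow> lim (\<lambda>n. wealth m lam X n \<omega>)"
      using main by eventually_elim (metis limI)
  qed
  have all: "ae_eq M {\<omega> \<in> space M. W \<omega> = 0} A0 \<and> ae_eq M {\<omega> \<in> space M. W \<omega> > 0} A1"
    if "is_as_limit M (wealth m lam X) W" for W
  proof -
    have [measurable]: "W \<in> borel_measurable M"
      and W: "AE \<omega> in M. (\<lambda>n. wealth m lam X n \<omega>) \<longlonglongrightarrow> W \<omega>"
      using that by (auto simp: is_as_limit_def)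
    \<comment> \<open>By uniqueness of limits any version \<open>W\<close> agrees almost surely with
      the limit found above. It is then nonnegative, so positive means nonzero.\<close>
    have ae: "AE \<omega> in M. 0 \<le> W \<omega> \<and> (W \<omega> = 0 \<longleftrightarrow> \<omega> \<in> A0)"
      using W main AE_space
    proof eventually_elim
      case (elim \<omega>)
      then show ?case unfolding mem0[OF elim(3)] by (metis LIMSEQ_unique)
    qed
    have "AE \<omega> in M. \<omega> \<in> {\<omega> \<in> space M. W \<omega> = 0} \<longleftrightarrow> \<omega> \<in> A0"
      using ae AE_space by eventually_elim blast
    moreover have "AE \<omega> in M. \<omega> \<in> {\<omega> \<in> space M. W \<omega> > 0} \<longleftrightarrow> \<omega> \<in> space M - A0"
      using ae AE_space
    proof eventually_elim
      case (elim \<omega>)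
      then show ?case unfolding Diff_iff mem_Collect_eq by (metis order_less_le)
    qed
    moreover have "{\<omega> \<in> space M. W \<omega> = 0} \<in> events" "{\<omega> \<in> space M. W \<omega> > 0} \<in> events" by measurable
    ultimately show ?thesis unfolding A1 ae_eq_def using ev0 by blast
  qed
  show ?thesis using ex all unfolding A0_def A1_def by blast
qed

end
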